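(* For every integer $n\ge 2$, there exists a simple series-parallel graph $G$ on $n$ vertices with $b(G)\le \lceil \log_2 n\rceil+1$.
   Context: A multigraph is series-parallel (SP) if it can be obtained from $K_2$ by a finite sequence of series extensions (replace an edge $\{x,y\}$ by a new vertex $z$ and edges $\{x,z\},\{z,y\}$) and parallel extensions (add an edge parallel to an existing edge); a simple graph is SP if it is the result of such a sequence with no multiple edges at the end. Broadcasting: initially only an originator holds a message; in each discrete time unit, every informed vertex may inform at most one uninformed neighbor. $b(v,G)$ is the minimum number of time units to inform all vertices from originator $v$, and $b(G)=\max_v b(v,G)$. *)

theory Defs
  imports Complex_Main "HOL-Library.Multiset" "HOL-Library.Extended_Nat"
begin

text \<open>A multigraph is given by its vertex set together with a multiset of edges, an edge being the
  set of its two endpoints; parallel edges are repeated elements of the multiset.\<close>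

inductive sp_multigraph :: "'a set \<Rightarrow> 'a set multiset \<Rightarrow> bool" where
  K2: "x \<noteq> y \<Longrightarrow> sp_multigraph {x, y} {#{x, y}#}"
| series: "\<lbrakk>sp_multigraph V M; {x, y} \<in># M; z \<notin> V\<rbrakk>
    \<Longrightarrow> sp_multigraph (insert z V) (M - {#{x, y}#} + {#{x, z}, {z, y}#})"
| parallel: "\<lbrakk>sp_multigraph V M; e \<in># M\<rbrakk> \<Longrightarrow> sp_multigraph V (add_mset e M)"

definition simple_graph :: "'a set \<Rightarrow> 'a set set \<Rightarrow> bool" where
  "simple_graph V E \<longleftrightarrow> finite V \<and> (\<forall>e\<in>E. e \<subseteq> V \<and> card e = 2)"

text \<open>Intermediate multigraphs may have multiple edges; only the last one must not.\<close>

definition series_parallel :: "'a set \<Rightarrow> 'a set set \<Rightarrow> bool" where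
  "series_parallel V E \<longleftrightarrow>
    (\<exists>M. sp_multigraph V M \<and> (\<forall>e. count M e \<le> 1) \<and> set_mset M = E)"

text \<open>One time unit of broadcasting takes the set \<open>S\<close> of informed vertices to \<open>S'\<close>. The partial
  function \<open>c\<close> sends each vertex that makes a call to the neighbour it informs; vertices outside
  its domain stay idle.\<close>

definition broadcast_round :: "'a set set \<Rightarrow> 'a set \<Rightarrow> 'a set \<Rightarrow> bool" where
  "broadcast_round E S S' \<longleftrightarrow>
    (\<exists>c :: 'a \<rightharpoonup> 'a. dom c \<subseteq> S \<and> (\<forall>u w. c u = Some w \<longrightarrow> w \<notin> S \<and> {u, w} \<in> E)
      \<and> S' = S \<union> ran c)"

text \<open>Values in \<^typ>\<open>enat\<close>: the infimum is \<open>\<infinity>\<close> when some vertex is not reachable from the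
  originator, and is otherwise attained.\<close>

definition broadcast_time_from :: "'a set \<Rightarrow> 'a set set \<Rightarrow> 'a \<Rightarrow> enat" where
  "broadcast_time_from V E v = (INF t \<in> {t. (broadcast_round E ^^ t) {v} V}. enat t)"

text \<open>For a finite nonempty vertex set the supremum is a maximum.\<close>

definition broadcast_time :: "'a set \<Rightarrow> 'a set set \<Rightarrow> enat" where
  "broadcast_time V E = (SUP v\<in>V. broadcast_time_from V E v)"

end

theory Submission
  imports Defs "HOL-Library.Discrete_Functions"
begin

text \<open>Join a hub 0 to every vertex of a tree on \<open>1, \<dots>, n - 1\<close>. Such a graph is series-parallel: a new
  leaf below \<open>p\<close> arises by doubling the edge \<open>{0, p}\<close> and subdividing the copy. Choose the tree so
  that, together with the edges at 0, it contains a binomial broadcast tree rooted at 0. Any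
  originator first calls the hub, which then reaches everyone in \<open>\<lceil>log\<^sub>2 n\<rceil>\<close> further rounds.\<close>

definition hub_edges :: "(nat \<Rightarrow> nat) \<Rightarrow> nat \<Rightarrow> nat set set" where
  "hub_edges q n = (\<lambda>m. {0, m}) ` {1..<n} \<union> (\<lambda>m. {m, q m}) ` {2..<n}"

lemma hub_edges_Suc:
  assumes "n \<ge> 2"
  shows "hub_edges q (Suc n) = insert {0, n} (insert {n, q n} (hub_edges q n))"
proof -
  have "{1..<Suc n} = insert n {1..<n}" "{2..<Suc n} = insert n {2..<n}"
    using assms by auto
  then show ?thesis by (auto simp: hub_edges_def)
qed

text \<open>Serves twice: it makes the final graph simple, and it shows that an edge at the vertex
  \<open>n\<close> is new to \<open>hub_edges q n\<close>.\<close>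

lemma hub_edges_subset:
  assumes "\<And>m. m \<ge> 2 \<Longrightarrow> 1 \<le> q m \<and> q m < m" and "e \<in> hub_edges q n"
  shows "e \<subseteq> {..<n} \<and> card e = 2"
  using assms(2) unfolding hub_edges_def
proof (elim UnE imageE)
  fix m assume "e = {m, q m}" "m \<in> {2..<n}"
  then show ?thesis using assms(1)[of m] by auto
qed auto

lemma sp_multigraph_hub:
  assumes q: "\<And>m. m \<ge> 2 \<Longrightarrow> 1 \<le> q m \<and> q m < m" and "n \<ge> 2"
  shows "sp_multigraph {..<n} (mset_set (hub_edges q n))"
  using \<open>n \<ge> 2\<close>
proof (induction n rule: dec_induct)
  case base
  have "{..<2} = {0, 1::nat}" "hub_edges q 2 = {{0, 1}}"
    by (auto simp: hub_edges_def numeral_2_eq_2)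
  then show ?case using sp_multigraph.K2[of "0::nat" 1] by simp
next
  case (step n)
  let ?M = "mset_set (hub_edges q n)"
  have fin: "finite (hub_edges q n)" by (simp add: hub_edges_def)
  have qn: "1 \<le> q n" "q n < n" using q[OF step(1)] by auto
  have e: "{0, q n} \<in># ?M"
    using fin qn by (auto simp: hub_edges_def)
  \<comment> \<open>The parallel copy of \<open>{0, q n}\<close> is the one that \<open>n\<close>
    subdivides, so the original edge survives. It is a hub edge because \<open>q n\<close> is at
    least 1.\<close>
  have "sp_multigraph (insert n {..<n})
      (add_mset {0, q n} ?M - {#{0, q n}#} + {#{0, n}, {n, q n}#})"
    by (rule sp_multigraph.series[OF sp_multigraph.parallel[OF step.IH e]]) auto
  \<comment> \<open>Being new and distinct, the two edges each enter \<open>mset_set\<close> exactly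
    once, so the multiset above is that of the enlarged edge set.\<close>
  moreover have "{0, n} \<notin> hub_edges q n" "{n, q n} \<notin> hub_edges q n"
    using hub_edges_subset[OF q, of _ n] by auto
  moreover have "{0, n} \<noteq> {n, q n}" using qn by (auto simp: doubleton_eq_iff)
  ultimately show ?case
    using fin step(1) by (simp add: hub_edges_Suc lessThan_Suc)
qed

lemma series_parallel_hub:
  assumes "\<And>m. m \<ge> 2 \<Longrightarrow> 1 \<le> q m \<and> q m < m" and "n \<ge> 2"
  shows "series_parallel {..<n} (hub_edges q n)"
proof -
  have "finite (hub_edges q n)" by (simp add: hub_edges_def)
  then show ?thesis
    unfolding series_parallel_def
    using sp_multigraph_hub[OF assms] by (intro exI[of _ "mset_set (hub_edges q n)"])
      (auto simp: count_mset_set')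
qed

lemma broadcast_time_from_le:
  "(broadcast_round E ^^ t) {v} V \<Longrightarrow> broadcast_time_from V E v \<le> enat t"
  unfolding broadcast_time_from_def by (rule INF_lower) simp

text \<open>In round \<open>t\<close> each \<open>i\<close> below \<open>2 ^ t\<close> calls the
  vertex obtained by setting bit \<open>t\<close>. The originator \<open>v\<close> is carried along
  separately, since it may be informed ahead of its turn.\<close>

lemma broadcast_round_doubling:
  fixes n :: nat
  assumes "\<And>i. i < 2 ^ t \<Longrightarrow> i + 2 ^ t < n \<Longrightarrow> {i, i + 2 ^ t} \<in> E"
  shows "broadcast_round E (insert v {..<min n (2 ^ t)}) (insert v {..<min n (2 ^ Suc t)})"
proof -
  \<comment> \<open>A call must reach an uninformed vertex, so the vertex whose target would be
    \<open>v\<close> stays idle.\<close>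
  define c where "c i = (if i < 2 ^ t \<and> i + 2 ^ t < n \<and> i + 2 ^ t \<noteq> v
    then Some (i + 2 ^ t) else None)" for i
  have "insert v {..<min n (2 ^ Suc t)} \<subseteq> insert v {..<min n (2 ^ t)} \<union> ran c"
  proof
    fix x assume x: "x \<in> insert v {..<min n (2 ^ Suc t)}"
    show "x \<in> insert v {..<min n (2 ^ t)} \<union> ran c"
    proof (cases "x = v \<or> x < 2 ^ t")
      case False
      then have "c (x - 2 ^ t) = Some x" using x by (auto simp: c_def)
      then show ?thesis by (auto intro: ranI)
    qed (use x in auto)
  qed
  then have "insert v {..<min n (2 ^ Suc t)} = insert v {..<min n (2 ^ t)} \<union> ran c"
    by (auto simp: c_def ran_def split: if_splits)
  then show ?thesis
    unfolding broadcast_round_def using assms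
    by (intro exI[of _ c]) (auto simp: c_def split: if_splits)
qed

lemma broadcast_doubling:
  fixes n :: nat
  assumes "\<And>t i. i < 2 ^ t \<Longrightarrow> i + 2 ^ t < n \<Longrightarrow> {i, i + 2 ^ t} \<in> E" and "n \<ge> 1"
  shows "(broadcast_round E ^^ t) {v, 0} (insert v {..<min n (2 ^ t)})"
proof (induction t)
  case 0
  have "{..<min n (2 ^ 0)} = {0}" using \<open>n \<ge> 1\<close> by auto
  then show ?case by simp
next
  case (Suc t)
  then show ?case using broadcast_round_doubling[OF assms(1)] by (auto intro: relpowp_Suc_I)
qed

text \<open>One round brings the message to the hub, and \<open>k\<close> doubling rounds then cover
  everything below \<open>2 ^ k\<close>.\<close>

lemma broadcast_time_hub_le:
  fixes n :: nat
  assumes dbl: "\<And>t i. i < 2 ^ t \<Longrightarrow> i + 2 ^ t < n \<Longrightarrow> {i, i + 2 ^ t} \<in> E"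
    and hub: "\<And>v. 1 \<le> v \<Longrightarrow> v < n \<Longrightarrow> {v, 0} \<in> E"
    and "n \<le> 2 ^ k"
  shows "broadcast_time {..<n} E \<le> enat (k + 1)"
  unfolding broadcast_time_def
proof (rule SUP_least)
  fix v assume "v \<in> {..<n}"
  then have v: "v < n" by simp
  then have "insert v {..<min n (2 ^ k)} = {..<n}" using \<open>n \<le> 2 ^ k\<close> by auto
  then have rounds: "(broadcast_round E ^^ k) {v, 0} {..<n}"
    using broadcast_doubling[of n E k v] dbl v by simp
  show "broadcast_time_from {..<n} E v \<le> enat (k + 1)"
  proof (cases "v = 0")
    \<comment> \<open>Here \<open>{v, 0}\<close> is already the initial set, so the call to the hub
      is saved.\<close>
    case True
    then have "broadcast_time_from {..<n} E v \<le> enat k"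
      using rounds by (intro broadcast_time_from_le) simp
    then show ?thesis by (rule order_trans) simp
  next
    case False
    then have "broadcast_round E {v} {v, 0}"
      unfolding broadcast_round_def using hub[of v] v
      by (intro exI[of _ "[v \<mapsto> 0]"]) auto
    then have "(broadcast_round E ^^ Suc k) {v} {..<n}"
      using rounds by (rule relpowp_Suc_I2)
    then show ?thesis using broadcast_time_from_le by fastforce
  qed
qed

text \<open>Clearing the top bit of \<open>m\<close> gives its parent in the binomial tree. Powers of two would be
  sent to the hub, so their parent is set to 1 instead.\<close>

definition binomial_parent :: "nat \<Rightarrow> nat" where
  "binomial_parent m = max 1 (m - 2 ^ floor_log m)"

lemma binomial_parent_bounds:
  assumes "m \<ge> 2"
  shows "1 \<le> binomial_parent m \<and> binomial_parent m < m"
  using assms floor_log_exp2_le[of m] by (auto simp: binomial_parent_def)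

text \<open>The top bit of \<open>i + 2 ^ t\<close> is \<open>2 ^ t\<close>, and
  \<open>0 < i\<close> keeps the cap at 1 from taking effect.\<close>

lemma binomial_parent_add:
  assumes "0 < i" "i < 2 ^ t"
  shows "binomial_parent (i + 2 ^ t) = i"
proof -
  have "floor_log (i + 2 ^ t) = t" by (rule floor_log_eqI) (use assms in auto)
  then show ?thesis using assms by (simp add: binomial_parent_def)
qed

theorem theorem4:
  fixes n :: nat
  assumes "n \<ge> 2"
  shows "\<exists>(V :: nat set) E. simple_graph V E \<and> card V = n \<and> series_parallel V E
    \<and> broadcast_time V E \<le> enat (nat \<lceil>log 2 (real n)\<rceil> + 1)"
proof (intro exI conjI)
  let ?E = "hub_edges binomial_parent n"
  show "simple_graph {..<n} ?E"
    using hub_edges_subset[OF binomial_parent_bounds] by (simp add: simple_graph_def)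
  show "card {..<n} = n" by simp
  show "series_parallel {..<n} ?E"
    using series_parallel_hub[OF binomial_parent_bounds assms] .
  show "broadcast_time {..<n} ?E \<le> enat (nat \<lceil>log 2 (real n)\<rceil> + 1)"
  proof (rule broadcast_time_hub_le)
    fix t i :: nat
    assume i: "i < 2 ^ t" "i + 2 ^ t < n"
    show "{i, i + 2 ^ t} \<in> ?E"
    \<comment> \<open>Calls made by 0 run along hub edges, so resetting the parents of powers of two
      does no harm; all other calls run along tree edges.\<close>
    proof (cases "i = 0")
      case False
      then have "{i + 2 ^ t, binomial_parent (i + 2 ^ t)} \<in> ?E"
        unfolding hub_edges_def using i by (intro UnI2 imageI) auto
      then show ?thesis using False i by (simp add: binomial_parent_add insert_commute)
    qed (use i in \<open>auto simp: hub_edges_def\<close>)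
  next
    fix v assume "1 \<le> v" "v < n"
    then show "{v, 0} \<in> ?E" by (auto simp: hub_edges_def insert_commute)
  next
    have "log 2 (real n) \<le> real (nat \<lceil>log 2 (real n)\<rceil>)"
      by (rule real_nat_ceiling_ge)
    then have "real n \<le> 2 powr real (nat \<lceil>log 2 (real n)\<rceil>)"
      using assms by (subst (asm) log_le_iff) auto
    then show "n \<le> 2 ^ nat \<lceil>log 2 (real n)\<rceil>"
      by (simp add: powr_realpow)
  qed
qed

end
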